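(* Let $(X,\mathcal I)$ be an ideal $G$-space, let $n\ge 1$, and let $X=A_1\cup\dots\cup A_n$ be a partition of $X$. Then either (i) $\mathrm{cov}(\Delta_{\mathcal I}(A_i))\le n$ for all $i\in\{1,\dots,n\}$, or else (ii) there are an index $i\in\{1,\dots,n\}$ and a $G$-invariant Boolean ideal $\mathcal J$ on $G$ with $\Delta_{\mathcal I}(A_i)\notin\mathcal J$ such that $\mathrm{cov}_{\mathcal J}(\Delta_{\mathcal I}(A_i))<n$.
   Context: A $G$-space is a set $X$ endowed with an action $G\times X\to X$, $(g,x)\mapsto gx$, of a group $G$. A Boolean ideal on a set $X$ is a nonempty proper subfamily $\mathcal I$ of the power set of $X$ such that for any $A,B\in\mathcal I$ every subset $C\subset A\cup B$ belongs to $\mathcal I$. A Boolean ideal $\mathcal I$ on a $G$-space $X$ is $G$-invariant if $gA\in\mathcal I$ for all $g\in G$, $A\in\mathcal I$. An ideal $G$-space is a pair $(X,\mathcal I)$ of a $G$-space $X$ and a $G$-invariant Boolean ideal $\mathcal I$ on $X$. A $G$-invariant Boolean ideal on the group $G$ is meant with respect to the left action of $G$ on itself (closed under left translations). For $A\subset X$ put $\Delta_{\mathcal I}(A)=\{g\in G: gA\cap A\notin\mathcal I\}$. For a non-empty $A\subset G$, $\mathrm{cov}(A)=\min\{|F|:F\subset G,\ G=FA\}$. For a Boolean ideal $\mathcal J$ on $G$ and $A,B\subset G$ write $A=_{\mathcal J}B$ if $A\triangle B\in\mathcal J$; for non-empty $A\subset G$, $\mathrm{cov}_{\mathcal J}(A)=\min\{|F|:F\subset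 G,\ FA=_{\mathcal J}G\}$. For the empty set both covering numbers are $\infty$, which is larger than any cardinal. *)

theory Defs
  imports
    "HOL-Algebra.Group_Action"
    "HOL-Library.Disjoint_Sets"
    "HOL-Library.Extended_Nat"
begin

definition boolean_ideal :: "'a set \<Rightarrow> 'a set set \<Rightarrow> bool" where
  "boolean_ideal X I \<longleftrightarrow>
     I \<noteq> {} \<and> I \<subset> Pow X \<and> (\<forall>A\<in>I. \<forall>B\<in>I. \<forall>C. C \<subseteq> A \<union> B \<longrightarrow> C \<in> I)"

definition invariant_family ::
    "('g, 'm) monoid_scheme \<Rightarrow> ('g \<Rightarrow> 'a \<Rightarrow> 'a) \<Rightarrow> 'a set set \<Rightarrow> bool" where
  "invariant_family G \<phi> I \<longleftrightarrow> (\<forall>g\<in>carrier G. \<forall>A\<in>I. \<phi> g ` A \<in> I)"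

locale ideal_G_space = group_action G X \<phi>
  for G :: "('g, 'm) monoid_scheme" (structure)
  and X :: "'x set" and \<phi> :: "'g \<Rightarrow> 'x \<Rightarrow> 'x" +
  fixes I :: "'x set set"
  assumes ideal: "boolean_ideal X I"
    and invariant: "invariant_family G \<phi> I"

text \<open>Invariance here is under left translations: \<^term>\<open>mult G g ` A\<close> is the translate
  \<open>gA\<close>.\<close>

definition invariant_boolean_ideal_on_group ::
    "('g, 'm) monoid_scheme \<Rightarrow> 'g set set \<Rightarrow> bool" where
  "invariant_boolean_ideal_on_group G J \<longleftrightarrow>
     boolean_ideal (carrier G) J \<and> invariant_family G (mult G) J"

definition Delta ::
    "('g, 'm) monoid_scheme \<Rightarrow> ('g \<Rightarrow> 'x \<Rightarrow> 'x) \<Rightarrow> 'x set set \<Rightarrow> 'x set \<Rightarrow> 'g set" where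
  "Delta G \<phi> I A = {g \<in> carrier G. \<phi> g ` A \<inter> A \<notin> I}"

text \<open>Covering numbers are valued in \<^typ>\<open>enat\<close>: all infinite cardinals, as well as the
  conventional value for the empty set, are identified with \<open>\<infinity>\<close>. Comparisons with natural
  numbers are unaffected by this. The infimum over a nonempty set of values is a minimum, since
  \<^typ>\<open>enat\<close> is well-ordered.\<close>

definition ecard :: "'a set \<Rightarrow> enat" where
  "ecard F = (if finite F then enat (card F) else \<infinity>)"

definition cov :: "('g, 'm) monoid_scheme \<Rightarrow> 'g set \<Rightarrow> enat" where
  "cov G A =
     (if A = {} then \<infinity>
      else Inf {ecard F | F. F \<subseteq> carrier G \<and> F <#>\<^bsub>G\<^esub> A = carrier G})"

definition eq_mod_ideal :: "'a set set \<Rightarrow> 'a set \<Rightarrow> 'a set \<Rightarrow> bool" where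
  "eq_mod_ideal J A B \<longleftrightarrow> (A - B) \<union> (B - A) \<in> J"

definition cov_mod :: "('g, 'm) monoid_scheme \<Rightarrow> 'g set set \<Rightarrow> 'g set \<Rightarrow> enat" where
  "cov_mod G J A =
     (if A = {} then \<infinity>
      else Inf {ecard F | F. F \<subseteq> carrier G \<and> eq_mod_ideal J (F <#>\<^bsub>G\<^esub> A) (carrier G)})"

end

theory Submission
  imports Defs "HOL-Analysis.Function_Topology"
begin

text \<open>Write \<open>D\<^sub>i\<close> for the set \<open>\<Delta>(A\<^sub>i)\<close>, and call a set separated if its translates of \<open>A\<^sub>i\<close> are pairwise
  disjoint modulo the ideal. The proof replaces an invariant mean, which need not exist, by weights
  \<open>s (i, g)\<close>, standing for the measure of \<open>gA\<^sub>i\<close> under a finitely additive probability measure on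
  \<open>X\<close> that vanishes on the ideal. Weights form a compact set closed under averaging over
  finitely many left translates. Minimising \<open>sup\<^sub>g s (i, g)\<close> for one \<open>i\<close> after the other leaves a nonempty
  set of weights, closed under averaging, on which every such supremum is a constant \<open>c\<^sub>i\<close>.
  If \<open>c\<^sub>i > 1/n\<close>, then \<open>{g. s (i, g) > 1/n}\<close> is thick, and it is covered by \<open>F D\<^sub>i\<close> for a maximal
  separated subset \<open>F\<close>, which has fewer than \<open>n\<close> elements since the weights of a separated set
  add up to at most 1; the complement of \<open>F D\<^sub>i\<close> generates the ideal of the second
  alternative. If all \<open>c\<^sub>i \<le> 1/n\<close>, then all weights equal \<open>1/n\<close>, so separated sets have at most \<open>n\<close>
  elements, and maximal ones witness \<open>cov D\<^sub>i \<le> n\<close>.\<close>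

section \<open>Separated sets, thick sets and weights on a group\<close>

text \<open>For \<open>D\<close> the set \<open>Delta G \<phi> I A\<close> with
  \<open>A \<subseteq> X\<close>, two translates \<open>fA\<close> and \<open>f'A\<close> with
  \<open>f \<noteq> f'\<close> meet in a member of the ideal. Phrased through \<open>D\<close>, the
  argument can stay inside the group.\<close>

definition separated :: "('g, 'm) monoid_scheme \<Rightarrow> 'g set \<Rightarrow> 'g set \<Rightarrow> bool" where
  "separated G D F \<longleftrightarrow> (\<forall>f\<in>F. \<forall>f'\<in>F. f \<noteq> f' \<longrightarrow> inv\<^bsub>G\<^esub> f \<otimes>\<^bsub>G\<^esub> f' \<notin> D)"

text \<open>For \<open>S\<close> inside the group, an equivalent condition is that no finitely many
  left translates of its complement cover the group.\<close>

definition thick :: "('g, 'm) monoid_scheme \<Rightarrow> 'g set \<Rightarrow> bool" where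
  "thick G S \<longleftrightarrow>
     (\<forall>E. finite E \<longrightarrow> E \<subseteq> carrier G \<longrightarrow> (\<exists>g\<in>carrier G. \<forall>e\<in>E. e \<otimes>\<^bsub>G\<^esub> g \<in> S))"

text \<open>The last clause is the case where \<open>A\<^sub>i\<close> is in the ideal. Weights at \<open>g \<notin> H\<close> are only required to
  lie in \<open>[0, 1]\<close>.\<close>

definition weights ::
    "('g, 'm) monoid_scheme \<Rightarrow> ('i \<Rightarrow> 'g set) \<Rightarrow> 'i set \<Rightarrow> 'g set \<Rightarrow> ('i \<times> 'g \<Rightarrow> real) set" where
  "weights G D C H = {s. (\<forall>p. 0 \<le> s p \<and> s p \<le> 1) \<and>
     (\<forall>g\<in>H. (\<Sum>i\<in>C. s (i, g)) = 1) \<and>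
     (\<forall>i\<in>C. \<forall>F. finite F \<and> F \<subseteq> H \<and> separated G (D i) F \<longrightarrow> (\<Sum>f\<in>F. s (i, f)) \<le> 1) \<and>
     (\<forall>i\<in>C. \<one>\<^bsub>G\<^esub> \<notin> D i \<longrightarrow> (\<forall>g\<in>H. s (i, g) = 0))}"

definition average ::
    "('g, 'm) monoid_scheme \<Rightarrow> 'g set \<Rightarrow> ('i \<times> 'g \<Rightarrow> real) \<Rightarrow> ('i \<times> 'g \<Rightarrow> real)" where
  "average G E s = (\<lambda>(i, g). (\<Sum>e\<in>E. s (i, e \<otimes>\<^bsub>G\<^esub> g)) / card E)"

definition average_closed :: "('g, 'm) monoid_scheme \<Rightarrow> ('i \<times> 'g \<Rightarrow> real) set \<Rightarrow> bool" where
  "average_closed G K \<longleftrightarrow>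
     (\<forall>s\<in>K. \<forall>E. finite E \<longrightarrow> E \<noteq> {} \<longrightarrow> E \<subseteq> carrier G \<longrightarrow> average G E s \<in> K)"

section \<open>Compactness: from weights on finite sets to weights on the whole group\<close>

lemma weightsD:
  assumes "s \<in> weights G D C H"
  shows "0 \<le> s p" "s p \<le> 1" "g \<in> H \<Longrightarrow> (\<Sum>i\<in>C. s (i, g)) = 1"
    "i \<in> C \<Longrightarrow> finite F \<Longrightarrow> F \<subseteq> H \<Longrightarrow> separated G (D i) F \<Longrightarrow> (\<Sum>f\<in>F. s (i, f)) \<le> 1"
    "i \<in> C \<Longrightarrow> \<one>\<^bsub>G\<^esub> \<notin> D i \<Longrightarrow> g \<in> H \<Longrightarrow> s (i, g) = 0"
  using assms unfolding weights_def by blast+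

lemma weights_antimono: "H \<subseteq> H' \<Longrightarrow> weights G D C H' \<subseteq> weights G D C H"
  by (rule subsetI, subst weights_def) (auto dest: weightsD)

lemma thick_mono:
  assumes "thick G S" "S \<subseteq> T"
  shows "thick G T"
  unfolding thick_def
proof (intro allI impI)
  fix E assume "finite E" "E \<subseteq> carrier G"
  then have "\<exists>g\<in>carrier G. \<forall>e\<in>E. e \<otimes>\<^bsub>G\<^esub> g \<in> S"
    using assms(1) by (simp add: thick_def)
  then show "\<exists>g\<in>carrier G. \<forall>e\<in>E. e \<otimes>\<^bsub>G\<^esub> g \<in> T" using assms(2) by blast
qed

lemma closed_weights: "closed (weights G D C H)"
  unfolding weights_def Ball_def
  by (intro closed_Collect_conj closed_Collect_all closed_Collect_imp open_Collect_const
      closed_Collect_le closed_Collect_eq continuous_intros continuous_on_product_coordinates)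

text \<open>Tychonoff's theorem, applied to a closed subset of a product of copies of
  \<open>[0, 1]\<close>.\<close>

lemma compact_weights: "compact (weights G D C H)"
proof -
  have "compactin (product_topology (\<lambda>p. euclidean) UNIV) (PiE UNIV (\<lambda>p. {0..1::real}))"
    by (subst compactin_PiE) simp
  then have "compact (PiE UNIV (\<lambda>p. {0..1::real}))"
    by (simp add: euclidean_product_topology)
  then have "compact (PiE UNIV (\<lambda>p. {0..1}) \<inter> weights G D C H)"
    by (intro compact_Int_closed closed_weights)
  moreover have "PiE UNIV (\<lambda>p. {0..1}) \<inter> weights G D C H = weights G D C H"
    by (auto simp: weights_def PiE_def)
  ultimately show ?thesis by simp
qed

text \<open>Each clause of \<open>weights\<close> involves only finitely many elements of
  \<open>H\<close>, so by compactness solutions on all finite sets yield one on the whole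
  group.\<close>

lemma weights_carrier_nonempty:
  assumes "\<And>H. finite H \<Longrightarrow> H \<subseteq> carrier G \<Longrightarrow> weights G D C H \<noteq> {}"
  shows "weights G D C (carrier G) \<noteq> {}"
proof -
  let ?\<H> = "{H. finite H \<and> H \<subseteq> carrier G}"
  \<comment> \<open>The choice \<open>H = {}\<close> gives the largest set of weights, which serves
    as the compact set for the finite intersection property.\<close>
  have "weights G D C {} \<inter> (\<Inter>H\<in>?\<H>. weights G D C H) \<noteq> {}"
  proof (rule compact_imp_fip_image[OF compact_weights closed_weights])
    fix \<F> assume "finite \<F>" "\<F> \<subseteq> ?\<H>"
    then have "weights G D C (\<Union>\<F>) \<noteq> {}"
      by (intro assms) auto
    moreover have "weights G D C (\<Union>\<F>) \<subseteq> weights G D C H" if "H = {} \<or> H \<in> \<F>" for H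
      using that by (intro weights_antimono) auto
    ultimately show "weights G D C {} \<inter> (\<Inter>H\<in>\<F>. weights G D C H) \<noteq> {}"
      by blast
  qed
  then obtain s where s: "\<And>H. finite H \<Longrightarrow> H \<subseteq> carrier G \<Longrightarrow> s \<in> weights G D C H"
    by blast
  have "s \<in> weights G D C (carrier G)"
    unfolding weights_def
  proof (intro CollectI conjI ballI allI impI)
    show "0 \<le> s p" "s p \<le> 1" for p
      using weightsD(1,2)[OF s[of "{}"]] by simp_all
    show "(\<Sum>i\<in>C. s (i, g)) = 1" if "g \<in> carrier G" for g
      using weightsD(3)[OF s[of "{g}"]] that by simp
    show "(\<Sum>f\<in>F. s (i, f)) \<le> 1"
      if "i \<in> C" "finite F \<and> F \<subseteq> carrier G \<and> separated G (D i) F" for i F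
      using weightsD(4)[OF s[of F]] that by simp
    show "s (i, g) = 0" if "i \<in> C" "\<one>\<^bsub>G\<^esub> \<notin> D i" "g \<in> carrier G" for i g
      using weightsD(5)[OF s[of "{g}"]] that by simp
  qed
  then show ?thesis by blast
qed

section \<open>Averaging weights over left translates\<close>

lemma average_le:
  assumes "finite E" "E \<noteq> {}" "\<And>e. e \<in> E \<Longrightarrow> s (i, e \<otimes>\<^bsub>G\<^esub> g) \<le> c"
  shows "average G E s (i, g) \<le> c"
proof -
  have "(\<Sum>e\<in>E. s (i, e \<otimes>\<^bsub>G\<^esub> g)) \<le> c * card E"
    using sum_bounded_above[of E "\<lambda>e. s (i, e \<otimes>\<^bsub>G\<^esub> g)" c] assms(3) by (simp add: mult.commute)
  then show ?thesis
    using assms(1,2) by (simp add: average_def divide_le_eq card_gt_0_iff)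
qed

context group
begin

lemma separated_translate:
  assumes "separated G D F" "F \<subseteq> carrier G" "e \<in> carrier G"
  shows "separated G D ((\<otimes>) e ` F)"
proof -
  have "inv (e \<otimes> f) \<otimes> (e \<otimes> f') = inv f \<otimes> f'" if "f \<in> F" "f' \<in> F" for f f'
  proof -
    have f: "f \<in> carrier G" "f' \<in> carrier G" using that assms(2) by auto
    then have "inv e \<otimes> (e \<otimes> f') = f'"
      using assms(3) by (simp add: m_assoc[symmetric])
    then show ?thesis
      using f assms(3) by (simp add: inv_mult_group m_assoc)
  qed
  then show ?thesis
    using assms(1) by (auto simp: separated_def)
qed

text \<open>Every clause survives left translation and convex combination; for separated sets this
  is \<open>separated_translate\<close>. Taking the whole group for \<open>H\<close> keeps the
  translated arguments inside \<open>H\<close>.\<close>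

lemma average_closed_weights:
  fixes D :: "'i \<Rightarrow> 'a set"
  shows "average_closed G (weights G D C (carrier G))"
  unfolding average_closed_def
proof (intro ballI allI impI)
  fix s :: "'i \<times> 'a \<Rightarrow> real" and E
  assume s: "s \<in> weights G D C (carrier G)" and E: "finite E" "E \<noteq> {}" "E \<subseteq> carrier G"
  have card: "real (card E) > 0" using E by (simp add: card_gt_0_iff)
  show "average G E s \<in> weights G D C (carrier G)"
    unfolding weights_def
  proof (intro CollectI conjI ballI allI impI)
    fix p :: "'i \<times> 'a"
    obtain i g where p: "p = (i, g)" by (cases p)
    show "0 \<le> average G E s p"
      using weightsD(1)[OF s] by (simp add: p average_def sum_nonneg)
    show "average G E s p \<le> 1"
      unfolding p using weightsD(2)[OF s] E by (intro average_le) auto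
  next
    fix g assume g: "g \<in> carrier G"
    have "(\<Sum>i\<in>C. average G E s (i, g)) = (\<Sum>e\<in>E. \<Sum>i\<in>C. s (i, e \<otimes> g)) / card E"
      by (simp add: average_def sum_divide_distrib[symmetric] sum.swap[of _ E])
    also have "(\<Sum>e\<in>E. \<Sum>i\<in>C. s (i, e \<otimes> g)) = (\<Sum>e\<in>E. 1)"
      using weightsD(3)[OF s] E g by (intro sum.cong refl) auto
    finally show "(\<Sum>i\<in>C. average G E s (i, g)) = 1" using card by simp
  next
    fix i F assume i: "i \<in> C" and F: "finite F \<and> F \<subseteq> carrier G \<and> separated G (D i) F"
    have "(\<Sum>f\<in>F. average G E s (i, f)) = (\<Sum>e\<in>E. \<Sum>f\<in>F. s (i, e \<otimes> f)) / card E"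
      by (simp add: average_def sum_divide_distrib[symmetric] sum.swap[of _ E])
    also have "(\<Sum>e\<in>E. \<Sum>f\<in>F. s (i, e \<otimes> f)) \<le> (\<Sum>e\<in>E. 1)"
    proof (rule sum_mono)
      fix e assume e: "e \<in> E"
      then have "inj_on ((\<otimes>) e) F"
        using E F by (intro inj_onI) (metis Units_eq Units_l_cancel subsetD)
      then have "(\<Sum>f\<in>F. s (i, e \<otimes> f)) = (\<Sum>f\<in>(\<otimes>) e ` F. s (i, f))"
        by (simp add: sum.reindex)
      also have "\<dots> \<le> 1"
      proof -
        have "finite ((\<otimes>) e ` F) \<and> (\<otimes>) e ` F \<subseteq> carrier G \<and> separated G (D i) ((\<otimes>) e ` F)"
          using E F e separated_translate by auto
        then show ?thesis using weightsD(4)[OF s] i by blast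
      qed
      finally show "(\<Sum>f\<in>F. s (i, e \<otimes> f)) \<le> 1" .
    qed
    finally show "(\<Sum>f\<in>F. average G E s (i, f)) \<le> 1" using card by (simp add: divide_right_mono)
  next
    fix i g assume "i \<in> C" "\<one> \<notin> D i" "g \<in> carrier G"
    then show "average G E s (i, g) = 0"
      using weightsD(5)[OF s] E by (auto simp: average_def intro!: sum.neutral)
  qed
qed

section \<open>Weights with minimal suprema\<close>

text \<open>The least possible supremum \<open>c\<close> is attained by compactness. The members of
  \<open>K\<close> bounded by \<open>c\<close> have supremum exactly \<open>c\<close> by minimality,
  and averaging preserves the bound.\<close>

lemma minimize_supremum:
  fixes K :: "('i \<times> 'a \<Rightarrow> real) set"
  assumes K: "compact K" "K \<noteq> {}" "average_closed G K"
    and bounds: "\<forall>s\<in>K. \<forall>p. 0 \<le> s p \<and> s p \<le> 1"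
  shows "\<exists>K' c. K' \<subseteq> K \<and> compact K' \<and> K' \<noteq> {} \<and> average_closed G K' \<and>
    (\<forall>s\<in>K'. (\<forall>g\<in>carrier G. s (i, g) \<le> c) \<and> (\<forall>d<c. \<exists>g\<in>carrier G. s (i, g) > d))"
proof -
  define L where "L t = {s. \<forall>g\<in>carrier G. s (i, g) \<le> (t :: real)}" for t
  define T where "T = {t. K \<inter> L t \<noteq> {}}"
  define c where "c = Inf T"
  have closed_L: "closed (L t)" for t
    unfolding L_def Ball_def
    by (intro closed_Collect_all closed_Collect_imp open_Collect_const
        closed_Collect_le continuous_intros continuous_on_product_coordinates)
  have "K \<subseteq> L 1" using bounds by (simp add: L_def subset_iff)
  then have "1 \<in> T" using K(2) unfolding T_def by blast
  have "bdd_below T"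
  proof
    fix t assume "t \<in> T"
    then obtain s where "s \<in> K" "s (i, \<one>) \<le> t"
      using one_closed unfolding T_def L_def by blast
    moreover from this have "0 \<le> s (i, \<one>)" using bounds by blast
    ultimately show "0 \<le> t" by simp
  qed
  have L_mono: "L t \<subseteq> L u" if "t \<le> u" for t u
    using that order_trans unfolding L_def by blast
  have above: "K \<inter> L t \<noteq> {}" if "t > c" for t
  proof -
    have "T \<noteq> {}" "Inf T < t" using \<open>1 \<in> T\<close> that by (auto simp: c_def)
    then have "\<exists>u\<in>T. u < t" by (rule cInf_lessD)
    then obtain u where "u \<in> T" "u < t" by blast
    then show ?thesis using L_mono[of u t] unfolding T_def by (auto dest: less_imp_le)
  qed
  \<comment> \<open>The infimum \<open>c\<close> is attained: the sets \<open>L t\<close> with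
    \<open>t > c\<close> are closed and nested, and each meets the compact set
    \<open>K\<close>.\<close>
  have "K \<inter> (\<Inter>t\<in>{c<..}. L t) \<noteq> {}"
  proof (rule compact_imp_fip_image[OF K(1) closed_L])
    fix U assume U: "finite U" "U \<subseteq> {c<..}"
    \<comment> \<open>The extra element \<open>c + 1\<close> keeps the minimum meaningful when
      \<open>U\<close> is empty.\<close>
    define m where "m = Min (insert (c + 1) U)"
    have "m > c" using U by (auto simp: m_def)
    then have "K \<inter> L m \<noteq> {}" by (rule above)
    moreover have "L m \<subseteq> L t" if "t \<in> U" for t
      using U that by (intro L_mono) (auto simp: m_def)
    ultimately show "K \<inter> (\<Inter>t\<in>U. L t) \<noteq> {}" by blast
  qed
  moreover have "(\<Inter>t\<in>{c<..}. L t) \<subseteq> L c"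
  proof
    fix s assume s: "s \<in> (\<Inter>t\<in>{c<..}. L t)"
    have "s (i, g) \<le> c" if "g \<in> carrier G" for g
    proof (rule dense_ge)
      fix t assume "c < t"
      then show "s (i, g) \<le> t" using s that by (simp add: L_def)
    qed
    then show "s \<in> L c" by (simp add: L_def)
  qed
  ultimately have "K \<inter> L c \<noteq> {}" by blast
  show ?thesis
  proof (intro exI conjI ballI allI impI)
    show "K \<inter> L c \<subseteq> K" by blast
    show "K \<inter> L c \<noteq> {}" by fact
    show "compact (K \<inter> L c)" using K(1) closed_L by (rule compact_Int_closed)
    show "average_closed G (K \<inter> L c)"
      unfolding average_closed_def
    proof (intro ballI allI impI IntI)
      fix s E assume s: "s \<in> K \<inter> L c" and E: "finite E" "E \<noteq> {}" "E \<subseteq> carrier G"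
      then show "average G E s \<in> K" using K(3) by (simp add: average_closed_def)
      have "average G E s (i, g) \<le> c" if "g \<in> carrier G" for g
        using s E that by (intro average_le) (auto simp: L_def)
      then show "average G E s \<in> L c" by (simp add: L_def)
    qed
    show "s (i, g) \<le> c" if "s \<in> K \<inter> L c" "g \<in> carrier G" for s g
      using that by (auto simp: L_def)
    show "\<exists>g\<in>carrier G. s (i, g) > d" if "s \<in> K \<inter> L c" "d < c" for s d
    proof (rule ccontr)
      assume "\<not> ?thesis"
      then have "s \<in> L d" by (simp add: L_def not_less)
      then have "d \<in> T" using that(1) unfolding T_def by blast
      then have "c \<le> d" using \<open>bdd_below T\<close> unfolding c_def by (rule cInf_lower)
      then show False using \<open>d < c\<close> by simp
    qed
  qed
qed

text \<open>One index is minimised after the other, each time inside the set found before. The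
  constants already fixed persist, since they are shared by all members of that set.\<close>

lemma constant_suprema:
  fixes K :: "('i \<times> 'a \<Rightarrow> real) set"
  assumes C: "finite C" and K: "compact K" "K \<noteq> {}" "average_closed G K"
    and bounds: "\<forall>s\<in>K. \<forall>p. 0 \<le> s p \<and> s p \<le> 1"
  shows "\<exists>K' c. K' \<subseteq> K \<and> compact K' \<and> K' \<noteq> {} \<and> average_closed G K' \<and>
    (\<forall>i\<in>C. \<forall>s\<in>K'. (\<forall>g\<in>carrier G. s (i, g) \<le> c i) \<and> (\<forall>d<c i. \<exists>g\<in>carrier G. s (i, g) > d))"
  using C
proof (induction C rule: finite_induct)
  case empty
  then show ?case using K by auto
next
  case (insert j C)
  then obtain K' c where K': "K' \<subseteq> K" "compact K'" "K' \<noteq> {}" "average_closed G K'"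
    and c: "\<And>i s. i \<in> C \<Longrightarrow> s \<in> K' \<Longrightarrow>
      (\<forall>g\<in>carrier G. s (i, g) \<le> c i) \<and> (\<forall>d<c i. \<exists>g\<in>carrier G. s (i, g) > d)"
    by blast
  have bounds': "\<forall>s\<in>K'. \<forall>p. 0 \<le> s p \<and> s p \<le> 1"
    using bounds K'(1) by blast
  obtain K'' a where K'': "K'' \<subseteq> K'" "compact K''" "K'' \<noteq> {}" "average_closed G K''"
    "\<forall>s\<in>K''. (\<forall>g\<in>carrier G. s (j, g) \<le> a) \<and> (\<forall>d<a. \<exists>g\<in>carrier G. s (j, g) > d)"
    using minimize_supremum[OF K'(2-4) bounds', of j] by (elim exE conjE) (rule that)
  have "\<forall>i\<in>insert j C. \<forall>s\<in>K''. (\<forall>g\<in>carrier G. s (i, g) \<le> (c(j := a)) i) \<and>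
      (\<forall>d<(c(j := a)) i. \<exists>g\<in>carrier G. s (i, g) > d)"
    using K'' c by auto
  moreover have "K'' \<subseteq> K" using K'(1) K''(1) by blast
  ultimately show ?case using K''(2-4)
    by (intro exI[of _ K''] exI[of _ "c(j := a)"] conjI)
qed

text \<open>An average of \<open>s\<close> still has supremum \<open>c\<close>, whereas each averaged value is at most \<open>c\<close>;
  hence at a near-maximum of the average all averaged values are close to \<open>c\<close>.\<close>

lemma thick_superlevel:
  assumes K: "average_closed G K" "s \<in> K" and b: "b < c"
    and le: "\<And>g. g \<in> carrier G \<Longrightarrow> s (i, g) \<le> c"
    and near: "\<And>s d. s \<in> K \<Longrightarrow> d < c \<Longrightarrow> \<exists>g\<in>carrier G. s (i, g) > d"
  shows "thick G {g \<in> carrier G. s (i, g) > b}"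
  unfolding thick_def
proof (intro allI impI)
  fix E assume E: "finite E" "E \<subseteq> carrier G"
  show "\<exists>g\<in>carrier G. \<forall>e\<in>E. e \<otimes> g \<in> {g \<in> carrier G. s (i, g) > b}"
  proof (cases "E = {}")
    case False
    then have card: "real (card E) > 0" using E by (simp add: card_gt_0_iff)
    have "average G E s \<in> K" using K E False by (auto simp: average_closed_def)
    \<comment> \<open>The slack is \<open>c - b\<close> divided by \<open>card E\<close>, so that
      the total deficit of the summands is below \<open>c - b\<close> and no single one can drop to
      \<open>b\<close>.\<close>
    moreover have "c - (c - b) / card E < c" using b card by simp
    ultimately obtain g where g: "g \<in> carrier G" "average G E s (i, g) > c - (c - b) / card E"
      using near by blast
    then have "(\<Sum>e\<in>E. s (i, e \<otimes> g)) > (c - (c - b) / card E) * card E"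
      using card by (simp add: average_def pos_less_divide_eq)
    also have "(c - (c - b) / card E) * card E = c * card E - (c - b)"
      using card by (simp add: field_simps)
    finally have sum: "(\<Sum>e\<in>E. s (i, e \<otimes> g)) > c * card E - (c - b)" .
    have "s (i, e \<otimes> g) > b" if e: "e \<in> E" for e
    proof -
      have "(\<Sum>e'\<in>E - {e}. s (i, e' \<otimes> g)) \<le> (card E - 1) * c"
        using sum_bounded_above[of "E - {e}" "\<lambda>e. s (i, e \<otimes> g)" c] le E g e by auto
      moreover have "(\<Sum>e'\<in>E. s (i, e' \<otimes> g)) = s (i, e \<otimes> g) + (\<Sum>e'\<in>E - {e}. s (i, e' \<otimes> g))"
        using E e by (simp add: sum.remove)
      moreover have "real (card E - 1) = real (card E) - 1"
        using card by auto
      ultimately show ?thesis using sum by (simp add: algebra_simps)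
    qed
    then show ?thesis using g E by blast
  qed auto
qed

section \<open>Coverings by translates and the ideal of a thick set\<close>

text \<open>Take a separated \<open>F\<close> of largest size. A further point of \<open>S\<close>
  cannot be added to it, hence lies in some \<open>fD\<close>; symmetry of \<open>D\<close> makes
  the order of the pair irrelevant, and \<open>\<one> \<in> D\<close> covers \<open>F\<close>
  itself.\<close>

lemma separated_cover:
  assumes D: "\<one> \<in> D" "\<And>g. g \<in> D \<Longrightarrow> inv g \<in> D" and S: "S \<subseteq> carrier G"
    and card: "\<And>F. finite F \<Longrightarrow> F \<subseteq> S \<Longrightarrow> separated G D F \<Longrightarrow> card F \<le> k"
  obtains F where "finite F" "F \<subseteq> S" "card F \<le> k" "S \<subseteq> F <#> D"
proof -
  let ?P = "\<lambda>F. finite F \<and> F \<subseteq> S \<and> separated G D F"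
  have "?P {}" "\<And>F. ?P F \<Longrightarrow> card F \<le> k" using card by (auto simp: separated_def)
  then have "\<exists>F. ?P F \<and> (\<forall>F'. ?P F' \<longrightarrow> card F' \<le> card F)"
    \<comment> \<open>The rule expects a strict bound, hence \<open>Suc k\<close>.\<close>
    by (intro ex_has_greatest_nat[where P = ?P and k = "{}" and b = "Suc k"]) (auto simp: le_imp_less_Suc)
  then obtain F where F: "?P F" and max: "\<And>F'. ?P F' \<Longrightarrow> card F' \<le> card F"
    by blast
  have "S \<subseteq> F <#> D"
  proof
    fix g assume g: "g \<in> S"
    then have gG: "g \<in> carrier G" using S by blast
    obtain f where f: "f \<in> F" "inv f \<otimes> g \<in> D"
    proof (cases "g \<in> F")
      case True
      then show ?thesis using that[of g] D(1) gG by simp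
    next
      case False
      then have "\<not> separated G D (insert g F)"
        using max[of "insert g F"] F g by auto
      then obtain f where f: "f \<in> F" "inv f \<otimes> g \<in> D \<or> inv g \<otimes> f \<in> D"
        using F unfolding separated_def by blast
      then have fG: "f \<in> carrier G" using F S by blast
      have "inv (inv g \<otimes> f) = inv f \<otimes> g" using fG gG by (simp add: inv_mult_group)
      then show ?thesis using that f D(2) by metis
    qed
    then have "g = f \<otimes> (inv f \<otimes> g)" using gG F S by (metis inv_solve_left' subsetD inv_closed m_closed)
    then show "g \<in> F <#> D" using f unfolding set_mult_def by blast
  qed
  then show ?thesis using that F card by blast
qed

text \<open>The ideal is generated by the left translates of the complement of \<open>F <#> D\<close>; thickness says
  that finitely many of these do not cover the group.\<close>

lemma thick_imp_cov_mod:
  assumes F: "finite F" "F \<subseteq> carrier G" and D: "D \<subseteq> carrier G" "D \<noteq> {}"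
    and thick: "thick G (F <#> D)"
  shows "\<exists>J. invariant_boolean_ideal_on_group G J \<and> D \<notin> J \<and> cov_mod G J D \<le> enat (card F)"
proof -
  define N where "N = carrier G - (F <#> D)"
  define J where "J = {B. \<exists>E. finite E \<and> E \<subseteq> carrier G \<and> B \<subseteq> E <#> N}"
  have NG: "N \<subseteq> carrier G" and FD: "F <#> D \<subseteq> carrier G"
    using F D set_mult_closed by (auto simp: N_def)
  have proper: "carrier G \<notin> J"
  proof
    assume "carrier G \<in> J"
    then obtain E where E: "finite E" "E \<subseteq> carrier G" "carrier G \<subseteq> E <#> N"
      by (auto simp: J_def)
    \<comment> \<open>Thickness for the inverses of \<open>E\<close> yields a point \<open>g\<close>
      that lies in no translate \<open>eN\<close> with \<open>e \<in> E\<close>.\<close>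
    have "finite (m_inv G ` E)" "m_inv G ` E \<subseteq> carrier G" using E by auto
    then have "\<exists>g\<in>carrier G. \<forall>e\<in>m_inv G ` E. e \<otimes> g \<in> F <#> D"
      using thick[unfolded thick_def, rule_format, of "m_inv G ` E"] by blast
    then obtain g where g: "g \<in> carrier G" "\<And>e. e \<in> E \<Longrightarrow> inv e \<otimes> g \<in> F <#> D"
      by auto
    obtain e t where t: "e \<in> E" "t \<in> N" "g = e \<otimes> t"
      using g(1) E(3) unfolding set_mult_def by blast
    then have "inv e \<otimes> g = t"
      using E NG by (metis inv_solve_left' subsetD m_closed)
    then have "t \<in> F <#> D" using g(2)[OF t(1)] by simp
    then show False using t(2) by (simp add: N_def)
  qed
  have un: "B \<in> J" if B: "B1 \<in> J" "B2 \<in> J" "B \<subseteq> B1 \<union> B2" for B B1 B2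
  proof -
    obtain E1 E2 where E: "finite E1" "E1 \<subseteq> carrier G" "B1 \<subseteq> E1 <#> N"
      "finite E2" "E2 \<subseteq> carrier G" "B2 \<subseteq> E2 <#> N"
      using B(1,2) unfolding J_def by blast
    then have "finite (E1 \<union> E2)" "E1 \<union> E2 \<subseteq> carrier G" by auto
    moreover have "(E1 \<union> E2) <#> N = (E1 <#> N) \<union> (E2 <#> N)"
      by (simp add: set_mult_def)
    then have "B \<subseteq> (E1 \<union> E2) <#> N"
      using B(3) E(3,6) by auto
    ultimately show ?thesis unfolding J_def by blast
  qed
  \<comment> \<open>A finite set \<open>Q\<close> covers both uses: \<open>Q = {g}\<close> for
    invariance, and \<open>Q = F\<close> for \<open>D \<notin> J\<close>.\<close>
  have translate: "Q <#> B \<in> J" if Q: "finite Q" "Q \<subseteq> carrier G" and B: "B \<in> J" for Q B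
  proof -
    obtain E where E: "finite E" "E \<subseteq> carrier G" "B \<subseteq> E <#> N"
      using B by (auto simp: J_def)
    have "Q <#> B \<subseteq> Q <#> (E <#> N)" using E(3) by (rule mono_set_mult[OF order_refl])
    also have "\<dots> = (Q <#> E) <#> N" using Q E NG by (simp add: set_mult_assoc)
    finally have "Q <#> B \<subseteq> (Q <#> E) <#> N" .
    moreover have "finite (Q <#> E)" using Q E by (simp add: set_mult_def)
    moreover have "Q <#> E \<subseteq> carrier G" using Q E by (simp add: set_mult_closed)
    ultimately show ?thesis unfolding J_def by blast
  qed
  have sub: "J \<subseteq> Pow (carrier G)"
  proof
    fix B assume "B \<in> J"
    then obtain E where "E \<subseteq> carrier G" "B \<subseteq> E <#> N" by (auto simp: J_def)
    then show "B \<in> Pow (carrier G)" using NG set_mult_closed[of E N] by auto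
  qed
  have "boolean_ideal (carrier G) J"
    unfolding boolean_ideal_def
  proof (intro conjI)
    show "J \<noteq> {}" unfolding J_def by blast
    show "J \<subset> Pow (carrier G)" using sub proper by blast
  qed (use un in blast)
  moreover have "invariant_family G (mult G) J"
    unfolding invariant_family_def
  proof (intro ballI)
    fix g B assume "g \<in> carrier G" "B \<in> J"
    then have "{g} <#> B \<in> J" by (intro translate) auto
    moreover have "{g} <#> B = mult G g ` B" by (auto simp: set_mult_def)
    ultimately show "mult G g ` B \<in> J" by simp
  qed
  moreover have N_J: "N \<in> J"
  proof -
    have "N \<subseteq> {\<one>} <#> N" using NG by (force simp: set_mult_def)
    then show ?thesis unfolding J_def by blast
  qed
  moreover have "D \<notin> J"
  proof
    assume "D \<in> J"
    then have "F <#> D \<in> J" using F translate by blast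
    then have "carrier G \<in> J" using N_J by (rule un) (auto simp: N_def)
    then show False using proper by blast
  qed
  moreover have "cov_mod G J D \<le> enat (card F)"
  proof -
    have "eq_mod_ideal J (F <#> D) (carrier G)"
      using N_J FD unfolding eq_mod_ideal_def N_def by (simp add: Diff_eq_empty_iff[THEN iffD2])
    then have "ecard F \<in> {ecard F | F. F \<subseteq> carrier G \<and> eq_mod_ideal J (F <#> D) (carrier G)}"
      using F(2) by blast
    then have "cov_mod G J D \<le> ecard F"
      using D(2) unfolding cov_mod_def by (auto intro: Inf_lower)
    then show ?thesis using F(1) by (simp add: ecard_def)
  qed
  ultimately show ?thesis unfolding invariant_boolean_ideal_on_group_def by blast
qed

lemma cov_le:
  assumes "F <#> D = carrier G" "finite F" "F \<subseteq> carrier G"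
  shows "cov G D \<le> enat (card F)"
proof -
  have "D \<noteq> {}" using assms(1) one_closed by (auto simp: set_mult_def)
  moreover have "ecard F \<in> {ecard F | F. F \<subseteq> carrier G \<and> F <#> D = carrier G}"
    using assms by blast
  ultimately have "cov G D \<le> ecard F" unfolding cov_def by (auto intro: Inf_lower)
  then show ?thesis using assms(2) by (simp add: ecard_def)
qed

section \<open>The dichotomy for finitely many symmetric subsets of a group\<close>

text \<open>The space and its partition enter only through \<open>nonempty\<close>, the existence of
  weights on finite sets of group elements.\<close>

theorem cov_or_cov_mod:
  fixes D :: "'i \<Rightarrow> 'a set"
  assumes C: "finite C" "C \<noteq> {}"
    and D: "\<And>i. i \<in> C \<Longrightarrow> D i \<subseteq> carrier G" "\<And>i g. i \<in> C \<Longrightarrow> g \<in> D i \<Longrightarrow> inv g \<in> D i"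
    and nonempty: "\<And>H. finite H \<Longrightarrow> H \<subseteq> carrier G \<Longrightarrow> weights G D C H \<noteq> {}"
  shows "(\<forall>i\<in>C. cov G (D i) \<le> enat (card C)) \<or>
    (\<exists>i\<in>C. \<exists>J. invariant_boolean_ideal_on_group G J \<and> D i \<notin> J \<and>
       cov_mod G J (D i) < enat (card C))"
proof (rule disjCI)
  assume no_ideal: "\<not> (\<exists>i\<in>C. \<exists>J. invariant_boolean_ideal_on_group G J \<and> D i \<notin> J \<and>
    cov_mod G J (D i) < enat (card C))"
  define n where "n = card C"
  have n: "n > 0" using C by (simp add: n_def card_gt_0_iff)
  let ?W = "weights G D C (carrier G)"
  have "?W \<noteq> {}" using nonempty by (rule weights_carrier_nonempty)
  moreover have "\<forall>s\<in>?W. \<forall>p. 0 \<le> s p \<and> s p \<le> 1"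
    using weightsD(1,2) by blast
  ultimately have "\<exists>K c. K \<subseteq> ?W \<and> compact K \<and> K \<noteq> {} \<and> average_closed G K \<and>
    (\<forall>i\<in>C. \<forall>s\<in>K. (\<forall>g\<in>carrier G. s (i, g) \<le> c i) \<and> (\<forall>d<c i. \<exists>g\<in>carrier G. s (i, g) > d))"
    by (intro constant_suprema C(1) compact_weights average_closed_weights)
  then obtain K c where K: "K \<subseteq> ?W" "K \<noteq> {}" "average_closed G K"
    and c: "\<forall>i\<in>C. \<forall>s\<in>K. (\<forall>g\<in>carrier G. s (i, g) \<le> c i) \<and>
      (\<forall>d<c i. \<exists>g\<in>carrier G. s (i, g) > d)"
    by (elim exE conjE) (rule that)
  have le: "s (i, g) \<le> c i" if "i \<in> C" "s \<in> K" "g \<in> carrier G" for i s g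
    using c that by blast
  have near: "\<exists>g\<in>carrier G. s (i, g) > d" if "i \<in> C" "s \<in> K" "d < c i" for i s d
    using c that by blast
  obtain s where s: "s \<in> K" using K(2) by blast
  then have sW: "s \<in> ?W" using K(1) by blast
  have sum_C: "(\<Sum>i\<in>C. s (i, g)) = 1" if "g \<in> carrier G" for g
    using weightsD(3)[OF sW that] .
  have sum_F: "(\<Sum>f\<in>F. s (i, f)) \<le> 1"
    if "i \<in> C" "finite F" "F \<subseteq> carrier G" "separated G (D i) F" for i F
    using weightsD(4)[OF sW that] .
  \<comment> \<open>By the last clause of \<open>weights\<close>, a positive weight supplies the
    hypothesis \<open>\<one> \<in> D i\<close> of \<open>separated_cover\<close>.\<close>
  have one_D: "\<one> \<in> D i" if "i \<in> C" "g \<in> carrier G" "s (i, g) > 0" for i g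
    using weightsD(5)[OF sW] that by (metis less_irrefl)
  have small: "c i \<le> 1 / n" if i: "i \<in> C" for i
  proof (rule ccontr)
    assume "\<not> ?thesis"
    then have c: "1 / n < c i" by simp
    define S where "S = {g \<in> carrier G. s (i, g) > 1 / n}"
    have thick: "thick G S"
      unfolding S_def using K(3) s c le near i by (intro thick_superlevel[where c = "c i"]) auto
    have "S \<noteq> {}" using near[OF i s c] by (auto simp: S_def)
    then obtain g where "g \<in> carrier G" "s (i, g) > 1 / n" by (auto simp: S_def)
    moreover from this have "s (i, g) > 0"
      using n by (meson divide_pos_pos less_trans of_nat_0_less_iff zero_less_one)
    ultimately have one: "\<one> \<in> D i" using one_D[OF i] by blast
    \<comment> \<open>Weights on \<open>S\<close> exceed \<open>1 / n\<close> strictly, which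
      improves the bound from \<open>n\<close> to \<open>n - 1\<close>. The empty set is treated
      apart because a strict inequality of sums needs a summand.\<close>
    have "card F \<le> n - 1" if F: "finite F" "F \<subseteq> S" "separated G (D i) F" for F
    proof (cases "F = {}")
      case False
      have "(\<Sum>f\<in>F. 1 / n) < (\<Sum>f\<in>F. s (i, f))"
        using F False by (intro sum_strict_mono) (auto simp: S_def)
      also have "\<dots> \<le> 1" using F i by (intro sum_F) (auto simp: S_def)
      finally show ?thesis using n by (simp add: field_simps)
    qed simp
    then obtain F where F: "finite F" "F \<subseteq> S" "card F \<le> n - 1" "S \<subseteq> F <#> D i"
      using separated_cover[of "D i" S "n - 1"] one D(2)[OF i] by (auto simp: S_def)
    have "thick G (F <#> D i)"
      using thick F(4) by (rule thick_mono)
    then obtain J where J: "invariant_boolean_ideal_on_group G J" "D i \<notin> J"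
      "cov_mod G J (D i) \<le> enat (card F)"
      using thick_imp_cov_mod[of F "D i"] F D(1)[OF i] one by (auto simp: S_def)
    have "enat (card F) < enat (card C)" using F(3) n by (simp add: n_def)
    then show False using J no_ideal i by (meson order_le_less_trans)
  qed
  \<comment> \<open>There are \<open>n\<close> weights at \<open>g\<close>, each at most
    \<open>1 / n\<close>, with sum 1, so none can be smaller.\<close>
  have eq: "s (i, g) = 1 / n" if i: "i \<in> C" and g: "g \<in> carrier G" for i g
  proof (rule ccontr)
    have all: "s (j, g) \<le> 1 / n" if "j \<in> C" for j
      using le[OF that s g] small[OF that] by simp
    assume "s (i, g) \<noteq> 1 / n"
    then have "(\<Sum>j\<in>C. s (j, g)) < (\<Sum>j\<in>C. 1 / n)"
      using C(1) i all by (intro sum_strict_mono_ex1) (auto simp: less_le)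
    then show False using sum_C[OF g] n by (simp add: n_def)
  qed
  show "\<forall>i\<in>C. cov G (D i) \<le> enat (card C)"
  proof
    fix i assume i: "i \<in> C"
    have one: "\<one> \<in> D i" using one_D[OF i one_closed] eq[OF i one_closed] n by simp
    have "card F \<le> n" if F: "finite F" "F \<subseteq> carrier G" "separated G (D i) F" for F
    proof -
      have "(\<Sum>f\<in>F. s (i, f)) = (\<Sum>f\<in>F. 1 / n)"
        using F eq[OF i] by (intro sum.cong) auto
      then have "card F / n \<le> 1" using sum_F[OF i F] by simp
      then show ?thesis using n by (simp add: divide_le_eq)
    qed
    then obtain F where F: "finite F" "F \<subseteq> carrier G" "card F \<le> n" "carrier G \<subseteq> F <#> D i"
      using separated_cover[of "D i" "carrier G" n] one D(2)[OF i] by auto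
    then have "F <#> D i = carrier G" using set_mult_closed D(1)[OF i] by blast
    then have "cov G (D i) \<le> enat (card F)" using F(1,2) by (rule cov_le)
    also have "\<dots> \<le> enat (card C)" using F(3) by (simp add: n_def)
    finally show "cov G (D i) \<le> enat (card C)" .
  qed
qed

end

section \<open>Weights from a partition of an ideal \<open>G\<close>-space\<close>

context ideal_G_space
begin

sublocale group G
  using group_hom by (simp add: group_hom_def)

lemma ideal_subset_Un:
  assumes "A \<in> I" "B \<in> I" "C \<subseteq> A \<union> B"
  shows "C \<in> I"
proof -
  have "\<forall>A\<in>I. \<forall>B\<in>I. \<forall>C. C \<subseteq> A \<union> B \<longrightarrow> C \<in> I"
    using ideal unfolding boolean_ideal_def by (elim conjE)
  then show ?thesis using assms by blast
qed

lemma ideal_subset_Pow: "I \<subset> Pow X"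
  using ideal by (simp add: boolean_ideal_def)

lemma ideal_Union:
  assumes "finite \<B>" "\<B> \<subseteq> I"
  shows "\<Union>\<B> \<in> I"
  using assms
proof (induction \<B> rule: finite_induct)
  case empty
  obtain B where "B \<in> I" using ideal unfolding boolean_ideal_def by blast
  then show ?case using ideal_subset_Un[of B B "{}"] by simp
next
  case (insert B \<B>)
  then show ?case using ideal_subset_Un[of B "\<Union>\<B>" "\<Union>(insert B \<B>)"] by simp
qed

lemma whole_notin_ideal: "X \<notin> I"
proof
  assume "X \<in> I"
  then have "Pow X \<subseteq> I" using ideal_subset_Un[of X X] by auto
  then show False using ideal_subset_Pow by blast
qed

lemma action_inv_image:
  assumes "g \<in> carrier G" "B \<subseteq> X"
  shows "\<phi> (inv g) ` \<phi> g ` B = B"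
  using assms orbit_sym_aux[OF assms(1) _ refl] by (force simp: image_image)

lemma action_mult_image:
  assumes "g \<in> carrier G" "h \<in> carrier G" "B \<subseteq> X"
  shows "\<phi> (g \<otimes> h) ` B = \<phi> g ` \<phi> h ` B"
  using assms composition_rule by (force simp: image_image)

lemma action_image_subset: "g \<in> carrier G \<Longrightarrow> B \<subseteq> X \<Longrightarrow> \<phi> g ` B \<subseteq> X"
  using surj_prop by blast

lemma translate_in_ideal_iff:
  assumes "g \<in> carrier G" "B \<subseteq> X"
  shows "\<phi> g ` B \<in> I \<longleftrightarrow> B \<in> I"
  using assms invariant action_inv_image unfolding invariant_family_def by (metis inv_closed)

text \<open>Translation by \<open>g\<close> carries the intersection in the definition of
  \<open>Delta\<close> to that of \<open>hB\<close> and \<open>gB\<close>, and invariance preserves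
  membership in \<open>I\<close> both ways. This translates \<open>separated\<close> into
  disjointness modulo \<open>I\<close>.\<close>

lemma mem_Delta_iff:
  assumes "g \<in> carrier G" "h \<in> carrier G" "B \<subseteq> X"
  shows "inv g \<otimes> h \<in> Delta G \<phi> I B \<longleftrightarrow> \<phi> h ` B \<inter> \<phi> g ` B \<notin> I"
proof -
  let ?k = "inv g \<otimes> h"
  have k: "?k \<in> carrier G" using assms by simp
  have "\<phi> g ` (\<phi> ?k ` B \<inter> B) = \<phi> g ` \<phi> ?k ` B \<inter> \<phi> g ` B"
    by (intro inj_on_image_Int[OF inj_prop[OF assms(1)]] action_image_subset k assms)
  also have "\<phi> g ` \<phi> ?k ` B = \<phi> (g \<otimes> ?k) ` B"
    using assms k by (simp add: action_mult_image)
  also have "g \<otimes> ?k = h" using assms by (simp add: m_assoc[symmetric])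
  finally have "\<phi> g ` (\<phi> ?k ` B \<inter> B) = \<phi> h ` B \<inter> \<phi> g ` B" .
  then show ?thesis
    using translate_in_ideal_iff[of g "\<phi> ?k ` B \<inter> B"] assms k by (auto simp: Delta_def)
qed

lemma inv_mem_Delta:
  assumes "g \<in> Delta G \<phi> I B" "B \<subseteq> X"
  shows "inv g \<in> Delta G \<phi> I B"
proof -
  have g: "g \<in> carrier G" using assms by (simp add: Delta_def)
  show ?thesis
    using mem_Delta_iff[of g \<one> B] mem_Delta_iff[of \<one> g B] g assms by (simp add: Int_commute)
qed

text \<open>The witness is the colouring \<open>g \<mapsto> i\<close> with \<open>x \<in> gA\<^sub>i\<close>, for a point \<open>x\<close> outside the finitely many
  intersections \<open>gA\<^sub>i \<inter> hA\<^sub>i\<close> that belong to the ideal.\<close>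

lemma weights_Delta_nonempty:
  assumes H: "finite H" "H \<subseteq> carrier G" and C: "finite C"
    and A: "(\<Union>i\<in>C. A i) = X" "disjoint_family_on A C"
  shows "weights G (\<lambda>i. Delta G \<phi> I (A i)) C H \<noteq> {}"
proof -
  \<comment> \<open>The pairs with \<open>g = h\<close> are included: they make \<open>x\<close>
    avoid \<open>gA\<close> for every part \<open>A\<close> in the ideal, as the last clause of
    \<open>weights\<close> demands.\<close>
  define R where "R = (\<lambda>(i, g, h). \<phi> h ` A i \<inter> \<phi> g ` A i) ` (C \<times> H \<times> H)"
  have AX: "A i \<subseteq> X" if "i \<in> C" for i using A(1) that by blast
  have "\<Union>(R \<inter> I) \<in> I"
    using H C by (intro ideal_Union) (auto simp: R_def)
  moreover have "\<Union>(R \<inter> I) \<subseteq> X"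
    using ideal_subset_Pow by blast
  ultimately have "\<Union>(R \<inter> I) \<subset> X"
    using whole_notin_ideal by (auto simp: psubset_eq)
  then obtain x where x: "x \<in> X" "x \<notin> \<Union>(R \<inter> I)"
    by (meson psubset_imp_ex_mem DiffD1 DiffD2)
  have mem: "inv g \<otimes> h \<in> Delta G \<phi> I (A i)"
    if "i \<in> C" "g \<in> H" "h \<in> H" "x \<in> \<phi> g ` A i" "x \<in> \<phi> h ` A i" for g h i
  proof -
    have "\<phi> h ` A i \<inter> \<phi> g ` A i \<in> R" using that by (force simp: R_def)
    then have "\<phi> h ` A i \<inter> \<phi> g ` A i \<notin> I" using x that by blast
    moreover have "g \<in> carrier G" "h \<in> carrier G" "A i \<subseteq> X" using that H AX by auto
    ultimately show ?thesis by (simp add: mem_Delta_iff)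
  qed
  define s where "s = (\<lambda>(i, g). if x \<in> \<phi> g ` A i then 1 else 0 :: real)"
  have "s \<in> weights G (\<lambda>i. Delta G \<phi> I (A i)) C H"
    unfolding weights_def
  proof (intro CollectI conjI ballI allI impI)
    show "0 \<le> s p" "s p \<le> 1" for p by (auto simp: s_def split: prod.split)
  next
    fix g assume "g \<in> H"
    then have g: "g \<in> carrier G" using H by blast
    have "x \<in> \<phi> g ` X" using x(1) surj_prop[OF g] by simp
    then obtain y where y: "y \<in> X" "\<phi> g y = x" by blast
    have "y \<in> (\<Union>i\<in>C. A i)" using y(1) A(1) by simp
    then obtain i where i: "i \<in> C" "y \<in> A i" by blast
    have "x \<in> \<phi> g ` A j \<longleftrightarrow> j = i" if j: "j \<in> C" for j
    proof
      assume "x \<in> \<phi> g ` A j"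
      then obtain z where z: "z \<in> A j" "\<phi> g z = x" by blast
      then have "z = y" using y inj_prop[OF g] AX[OF j] by (auto dest: inj_onD)
      then show "j = i" using A(2) z i j unfolding disjoint_family_on_def by blast
    qed (use y i in blast)
    then have "(\<Sum>j\<in>C. s (j, g)) = (\<Sum>j\<in>C. if j = i then 1 else 0)"
      by (intro sum.cong) (auto simp: s_def)
    then show "(\<Sum>j\<in>C. s (j, g)) = 1" using C i by simp
  next
    fix i F assume i: "i \<in> C"
      and F: "finite F \<and> F \<subseteq> H \<and> separated G (Delta G \<phi> I (A i)) F"
    let ?F = "{f \<in> F. x \<in> \<phi> f ` A i}"
    have "(\<Sum>f\<in>F. s (i, f)) = card ?F"
      using F by (simp add: s_def sum.If_cases Int_def)
    \<comment> \<open>Two different translates of \<open>A i\<close> containing \<open>x\<close>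
      would meet outside the ideal, against separation.\<close>
    moreover have "\<forall>f\<in>?F. \<forall>f'\<in>?F. f = f'"
      using F mem[OF i] unfolding separated_def by blast
    then have "card ?F \<le> 1" using F card_le_Suc0_iff_eq[of ?F] by simp
    ultimately show "(\<Sum>f\<in>F. s (i, f)) \<le> 1" by simp
  next
    fix i g assume "i \<in> C" "\<one> \<notin> Delta G \<phi> I (A i)" "g \<in> H"
    then show "s (i, g) = 0" using mem[of i g g] H by (auto simp: s_def l_inv)
  qed
  then show ?thesis by blast
qed

end

theorem theorem2:
  fixes G :: "('g, 'm) monoid_scheme"
    and X :: "'x set"
    and \<phi> :: "'g \<Rightarrow> 'x \<Rightarrow> 'x"
    and I :: "'x set set"
    and n :: nat
    and A :: "nat \<Rightarrow> 'x set"
  assumes "ideal_G_space G X \<phi> I"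
    and "n \<ge> 1"
    and "(\<Union>i\<in>{1..n}. A i) = X"
    and "disjoint_family_on A {1..n}"
  shows "(\<forall>i\<in>{1..n}. cov G (Delta G \<phi> I (A i)) \<le> enat n) \<or>
         (\<exists>i\<in>{1..n}. \<exists>J. invariant_boolean_ideal_on_group G J \<and>
            Delta G \<phi> I (A i) \<notin> J \<and>
            cov_mod G J (Delta G \<phi> I (A i)) < enat n)"
proof -
  interpret ideal_G_space G X \<phi> I by fact
  have "A i \<subseteq> X" if "i \<in> {1..n}" for i using assms(3) that by blast
  then show ?thesis
    using cov_or_cov_mod[of "{1..n}" "\<lambda>i. Delta G \<phi> I (A i)"] assms(2)
      weights_Delta_nonempty[OF _ _ _ assms(3,4)] inv_mem_Delta
    by (simp add: Delta_def)
qed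

end
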